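(* Let $R$ be a ring and let $I$ be a principal N-pure ideal of $R$. Then there exists $n\geqslant 1$ such that $\operatorname{End}(I^{i})$ is a commutative ring for each $i\geqslant n$.
   Context: All rings are commutative with identity. $N(R)$ denotes the nilradical of $R$. An ideal $I$ of $R$ is called N-pure if for every $a\in I$ there exists $b\in I$ such that $a(1-b)\in N(R)$. $\operatorname{End}(I^i)$ denotes the ring of $R$-module endomorphisms of the ideal $I^i$ (multiplication being composition). *)

theory Defs
  imports "HOL-Algebra.Ideal_Product" "HOL-Algebra.Module"
begin

definition nilradical :: "('a, 'm) ring_scheme \<Rightarrow> 'a set"
  where "nilradical R = {x \<in> carrier R. \<exists>k::nat. k \<ge> 1 \<and> x [^]\<^bsub>R\<^esub> k = \<zero>\<^bsub>R\<^esub>}"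

definition N_pure_ideal :: "'a set \<Rightarrow> ('a, 'm) ring_scheme \<Rightarrow> bool"
  where "N_pure_ideal I R \<longleftrightarrow>
    ideal I R \<and> (\<forall>a\<in>I. \<exists>b\<in>I. a \<otimes>\<^bsub>R\<^esub> (\<one>\<^bsub>R\<^esub> \<ominus>\<^bsub>R\<^esub> b) \<in> nilradical R)"

text \<open>Powers in \<^term>\<open>ideals_set R\<close> are taken with respect to \<^const>\<open>ideal_prod\<close>,
  so the power with exponent 0 is the unit ideal.\<close>

abbreviation ideal_power :: "('a, 'm) ring_scheme \<Rightarrow> 'a set \<Rightarrow> nat \<Rightarrow> 'a set"
  where "ideal_power R I i \<equiv> I [^]\<^bsub>ideals_set R\<^esub> i"

text \<open>The record type of modules contains the fields \<^const>\<open>mult\<close> and \<^const>\<open>one\<close>, on which the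
  locale \<^locale>\<open>module\<close> puts no condition; their values below play no role
  (\<open>\<one>\<^bsub>R\<^esub>\<close> need not lie in \<open>I\<close>).\<close>

definition ideal_module :: "('a, 'm) ring_scheme \<Rightarrow> 'a set \<Rightarrow> ('a, 'a) module"
  where "ideal_module R I =
    \<lparr> carrier = I, mult = mult R, one = one R, zero = zero R, add = add R, smult = mult R \<rparr>"

text \<open>Endomorphisms are taken to be extensional, i.e. \<^const>\<open>undefined\<close> outside the carrier,
  so that equality in the endomorphism ring is equality of maps on the carrier.\<close>

definition module_End :: "('r, 'm) ring_scheme \<Rightarrow> ('r, 'a, 'n) module_scheme \<Rightarrow> ('a \<Rightarrow> 'a) set"
  where "module_End R M =
    {f \<in> carrier M \<rightarrow>\<^sub>E carrier M.
       (\<forall>x\<in>carrier M. \<forall>y\<in>carrier M. f (x \<oplus>\<^bsub>M\<^esub> y) = f x \<oplus>\<^bsub>M\<^esub> f y) \<and>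
       (\<forall>r\<in>carrier R. \<forall>x\<in>carrier M. f (r \<odot>\<^bsub>M\<^esub> x) = r \<odot>\<^bsub>M\<^esub> f x)}"

definition End_ring :: "('r, 'm) ring_scheme \<Rightarrow> ('r, 'a, 'n) module_scheme \<Rightarrow> ('a \<Rightarrow> 'a) ring"
  where "End_ring R M =
    \<lparr> carrier = module_End R M,
      mult = compose (carrier M),
      one = (\<lambda>x\<in>carrier M. x),
      zero = (\<lambda>x\<in>carrier M. \<zero>\<^bsub>M\<^esub>),
      add = (\<lambda>f g. \<lambda>x\<in>carrier M. f x \<oplus>\<^bsub>M\<^esub> g x) \<rparr>"

lemma (in cring) ideal_module_is_module:
  assumes "ideal I R"
  shows "module R (ideal_module R I)"
proof -
  interpret I: ideal I R by fact
  have sub: "x \<in> carrier R" if "x \<in> I" for x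
    using that by (rule I.Icarr)
  have neg: "\<exists>y\<in>I. x \<oplus> y = \<zero>" if "x \<in> I" for x
    using that I.a_inv_closed[OF that] sub r_neg by blast
  show ?thesis
    by (rule moduleI, rule cring_axioms, rule abelian_groupI)
       (auto simp: ideal_module_def sub I.I_l_closed a_ac l_distr r_distr m_assoc
             intro: neg)
qed

lemma (in module) End_ring_is_ring: "ring (End_ring R M)"
proof (rule ringI)
  have neg: "\<exists>g\<in>module_End R M. (\<lambda>x\<in>carrier M. g x \<oplus>\<^bsub>M\<^esub> f x) = (\<lambda>x\<in>carrier M. \<zero>\<^bsub>M\<^esub>)"
    if "f \<in> module_End R M" for f
    using that
    by (intro bexI[of _ "\<lambda>x\<in>carrier M. \<ominus>\<^bsub>M\<^esub> f x"])
       (auto simp: module_End_def PiE_iff M.l_neg M.minus_add smult_r_minus cong: restrict_cong)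
  show "abelian_group (End_ring R M)"
    by (rule abelian_groupI)
       (use neg in \<open>auto simp: End_ring_def module_End_def PiE_iff M.a_ac smult_r_distr
          extensional_def fun_eq_iff\<close>)
  show "monoid (End_ring R M)"
    by (rule monoidI)
       (auto simp: End_ring_def module_End_def PiE_iff compose_def extensional_def fun_eq_iff)
qed (auto simp: End_ring_def module_End_def PiE_iff compose_def)

end

theory Submission
  imports Defs
begin

text \<open>If \<open>I\<close> is generated by \<open>a\<close>, then \<open>I\<^sup>i\<close> is generated by \<open>a\<^sup>i\<close>
  (\<open>ideal_power_cgenideal\<close>), so every power of \<open>I\<close> is a cyclic module.  An endomorphism \<open>f\<close> of a
  cyclic module with generator \<open>c\<close> is the multiplication by a scalar: writing
  \<open>f c = r \<odot> c\<close>, linearity forces \<open>f (s \<odot> c) = s \<odot> (r \<odot> c) = r \<odot> (s \<odot> c)\<close>.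
  Scalars of a commutative ring commute, hence so do the endomorphisms
  (\<open>End_ring_cring_if_cyclic\<close>).  The bound \<open>n = 1\<close> therefore works.\<close>

lemma (in module) module_End_cyclic_scalar:
  assumes c: "c \<in> carrier M"
    and gen: "\<And>x. x \<in> carrier M \<Longrightarrow> \<exists>s\<in>carrier R. x = s \<odot>\<^bsub>M\<^esub> c"
    and f: "f \<in> module_End R M"
  obtains r where "r \<in> carrier R" "\<And>x. x \<in> carrier M \<Longrightarrow> f x = r \<odot>\<^bsub>M\<^esub> x"
proof -
  have "f c \<in> carrier M"
    using f c by (auto simp: module_End_def)
  then obtain r where r: "r \<in> carrier R" "f c = r \<odot>\<^bsub>M\<^esub> c"
    using gen by blast
  have "f x = r \<odot>\<^bsub>M\<^esub> x" if x: "x \<in> carrier M" for x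
  proof -
    obtain s where s: "s \<in> carrier R" "x = s \<odot>\<^bsub>M\<^esub> c"
      using gen[OF x] by blast
    have "f x = s \<odot>\<^bsub>M\<^esub> (r \<odot>\<^bsub>M\<^esub> c)"
      using f c s r by (simp add: module_End_def)
    also have "\<dots> = r \<odot>\<^bsub>M\<^esub> x"
      using s r c by (metis smult_assoc1 R.m_comm)
    finally show ?thesis .
  qed
  with r that show thesis by blast
qed

lemma (in module) End_ring_cring_if_cyclic:
  assumes c: "c \<in> carrier M"
    and gen: "\<And>x. x \<in> carrier M \<Longrightarrow> \<exists>s\<in>carrier R. x = s \<odot>\<^bsub>M\<^esub> c"
  shows "cring (End_ring R M)"
proof -
  interpret E: ring "End_ring R M" by (rule End_ring_is_ring)
  have "compose (carrier M) f g = compose (carrier M) g f"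
    if f: "f \<in> module_End R M" and g: "g \<in> module_End R M" for f g
  proof -
    obtain r where r: "r \<in> carrier R" "\<And>x. x \<in> carrier M \<Longrightarrow> f x = r \<odot>\<^bsub>M\<^esub> x"
      using module_End_cyclic_scalar[OF c gen f] by blast
    obtain s where s: "s \<in> carrier R" "\<And>x. x \<in> carrier M \<Longrightarrow> g x = s \<odot>\<^bsub>M\<^esub> x"
      using module_End_cyclic_scalar[OF c gen g] by blast
    have "f (g x) = g (f x)" if "x \<in> carrier M" for x
      using r s that by (simp add: smult_assoc1[symmetric] R.m_comm)
    then show ?thesis
      by (auto simp: compose_def restrict_def)
  qed
  then have "comm_monoid (End_ring R M)"
    by (intro E.monoid_comm_monoidI) (simp add: End_ring_def)
  then show ?thesis
    by (rule cring.intro[OF E.ring_axioms])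
qed

lemma (in cring) ideal_prod_cgenideal:
  assumes "a \<in> carrier R" "b \<in> carrier R"
  shows "(PIdl a) \<cdot> (PIdl b) = PIdl (a \<otimes> b)"
proof -
  have "ideal (PIdl (a \<otimes> b)) R"
    using assms by (simp add: cgenideal_ideal)
  then have "Idl (PIdl (a \<otimes> b)) = PIdl (a \<otimes> b)"
    by (meson genideal_minimal genideal_self ideal.Icarr subsetI subset_antisym)
  then show ?thesis
    using assms by (simp add: ideal_prod_eq_genideal cgenideal_ideal cgenideal_prod)
qed

lemma (in cring) ideal_power_cgenideal:
  assumes a: "a \<in> carrier R"
  shows "ideal_power R (PIdl a) i = PIdl (a [^] i)"
proof (induction i)
  case 0
  have "PIdl \<one> = carrier R"
    unfolding cgenideal_def by force
  then show ?case by (simp add: ideals_set_def)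
next
  case (Suc i)
  \<comment> \<open>The product in \<open>ideals_set R\<close> is unfolded in isolation, so that the
    hypothesis still matches the power formed in that structure.\<close>
  have "ideal_power R (PIdl a) (Suc i) = ideal_power R (PIdl a) i \<cdot> (PIdl a)"
    by (simp add: ideals_set_def)
  then show ?case
    using a by (simp add: Suc.IH ideal_prod_cgenideal)
qed

theorem lemma3p21:
  fixes R :: "('a, 'm) ring_scheme" and I :: "'a set"
  assumes "cring R"
    and "principalideal I R"
    and "N_pure_ideal I R"
  shows "\<exists>n\<ge>1. \<forall>i\<ge>n. cring (End_ring R (ideal_module R (ideal_power R I i)))"
proof -
  interpret cring R by fact
  obtain a where a: "a \<in> carrier R" and I: "I = PIdl\<^bsub>R\<^esub> a"
    using principalideal.generate[OF assms(2)] cgenideal_eq_genideal by metis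
  have "cring (End_ring R (ideal_module R (ideal_power R I i)))" for i
  proof -
    define c where "c = a [^]\<^bsub>R\<^esub> i"
    have c: "c \<in> carrier R" using a by (simp add: c_def)
    interpret M: module R "ideal_module R (PIdl\<^bsub>R\<^esub> c)"
      by (rule ideal_module_is_module[OF cgenideal_ideal[OF c]])
    have "cring (End_ring R (ideal_module R (PIdl\<^bsub>R\<^esub> c)))"
    proof (rule M.End_ring_cring_if_cyclic)
      show "c \<in> carrier (ideal_module R (PIdl\<^bsub>R\<^esub> c))"
        using cgenideal_self[OF c] by (simp add: ideal_module_def)
    qed (auto simp: ideal_module_def cgenideal_def)
    then show ?thesis
      by (simp add: I c_def ideal_power_cgenideal[OF a])
  qed
  then show ?thesis by blast
qed

end
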